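(* Let $d\ge 3$, let $M=\{(u,v)\in\mathbb{R}^d\times\mathbb{R}^d : |u|=|v|=|u-v|=1\}$, and let $\mu$ be the surface measure on $M$, normalized to be a probability measure. Then for every continuous function $f$ on $M$, $$\int_M f(x,y)\,d\mu(x,y)=\int_{SO(d)}f\left(Re_1,\ R\left[\tfrac12e_1+\tfrac{\sqrt3}{2}e_2\right]\right)dR=\int_{SO(d)}f\left(R\left[\tfrac12e_1+\tfrac{\sqrt3}{2}e_2\right],\ Re_1\right)dR.$$
   Context: $M$ is a compact submanifold of $\mathbb{R}^{2d}$ and the surface measure is the one induced from the Euclidean metric of $\mathbb{R}^{2d}$. $SO(d)$ is the special orthogonal group, $dR$ is its Haar measure normalized to be a probability measure, and $e_i$ is the $i$th standard basis vector of $\mathbb{R}^d$. *)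

theory Defs
  imports "HOL-Probability.Probability"
begin

text \<open>
  The \<open>C\<^sup>1\<close> local parametrizations of a \<open>k\<close>-dimensional submanifold \<open>S\<close>, where \<open>k = CARD('k)\<close>:
  immersions \<open>\<phi>\<close>, with derivative \<open>\<phi>'\<close>, that map an open subset \<open>U\<close> of \<open>\<real>\<^sup>k\<close> homeomorphically
  onto a relatively open subset of \<open>S\<close>.
\<close>

definition local_parametrization ::
    "'a::euclidean_space set \<Rightarrow> (real^'k) set \<Rightarrow> (real^'k \<Rightarrow> 'a) \<Rightarrow> (real^'k \<Rightarrow> real^'k \<Rightarrow> 'a) \<Rightarrow> bool"
  where "local_parametrization S U \<phi> \<phi>' \<longleftrightarrow>
    open U \<and>
    openin (top_of_set S) (\<phi> ` U) \<and>
    (\<exists>\<psi>. homeomorphism U (\<phi> ` U) \<phi> \<psi>) \<and>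
    (\<forall>x\<in>U. (\<phi> has_derivative \<phi>' x) (at x) \<and> inj (\<phi>' x)) \<and>
    (\<forall>v. continuous_on U (\<lambda>x. \<phi>' x v))"

text \<open>
  The Riemannian volume density \<open>sqrt (det g)\<close> in a chart: \<open>g\<close> is the pullback of the Euclidean
  metric under the derivative \<open>L\<close>, in coordinates the Gram matrix of the partial derivatives.
\<close>

definition volume_density :: "(real^'k \<Rightarrow> 'a::euclidean_space) \<Rightarrow> real"
  where "volume_density L =
    sqrt (det ((\<chi> i j. L (axis i 1) \<bullet> L (axis j 1)) :: real^'k^'k))"

text \<open>
  \<open>\<sigma>\<close> is the (unnormalized) measure induced on \<open>S\<close> by the Euclidean metric of the ambient space.
  The type argument fixes the dimension \<open>CARD('k)\<close>. If \<open>S\<close> is not a submanifold of that dimension,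
  it need not be covered by parametrizations and \<open>\<sigma>\<close> is then not determined.
\<close>

definition surface_measure :: "'k::finite itself \<Rightarrow> 'a::euclidean_space set \<Rightarrow> 'a measure \<Rightarrow> bool"
  where "surface_measure k S \<sigma> \<longleftrightarrow>
    space \<sigma> = S \<and> sets \<sigma> = sets (restrict_space borel S) \<and>
    (\<forall>(U :: (real^'k) set) \<phi> \<phi>' B.
      local_parametrization S U \<phi> \<phi>' \<longrightarrow> B \<in> sets borel \<longrightarrow> B \<subseteq> U \<longrightarrow>
        emeasure \<sigma> (\<phi> ` B) = (\<integral>\<^sup>+x\<in>B. ennreal (volume_density (\<phi>' x)) \<partial>lborel))"

definition normalized_measure :: "'a measure \<Rightarrow> 'a measure"
  where "normalized_measure \<sigma> = scale_measure (1 / emeasure \<sigma> (space \<sigma>)) \<sigma>"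


definition SO :: "(real^'n^'n) set"
  where "SO = {R. rotation_matrix R}"

text \<open>
  Since the group is compact and metrizable, every Borel probability measure on it is regular, and
  left invariance implies right invariance and uniqueness.
\<close>

definition haar_probability_SO :: "(real^'n^'n) measure \<Rightarrow> bool"
  where "haar_probability_SO H \<longleftrightarrow>
    prob_space H \<and> space H = SO \<and> sets H = sets (restrict_space borel SO) \<and>
    (\<forall>Q\<in>SO. distr H H (\<lambda>R. Q ** R) = H)"


definition triangle_manifold :: "((real^'n) \<times> (real^'n)) set"
  where "triangle_manifold = {(u, v). norm u = 1 \<and> norm v = 1 \<and> norm (u - v) = 1}"

end

theory Submission
  imports Defs
begin

text \<open>
  \<open>SO(d)\<close> acts on \<open>M\<close> diagonally, by restrictions of linear isometries of the ambient space, so it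
  carries charts to charts with the same volume density and \<open>\<mu>\<close> is invariant. For \<open>d \<ge> 3\<close> the action
  is transitive. If \<open>\<nu>\<close> is any invariant probability measure on \<open>M\<close> and \<open>x\<^sub>0 \<in> M\<close>, averaging
  \<open>\<integral> F d\<nu> = \<integral> F(R\<inverse> x) d\<nu>(x)\<close> over \<open>R\<close> and exchanging the integrals gives
  \<open>\<integral> F d\<nu> = \<integral> F(R\<inverse> x\<^sub>0) dR\<close>, because the inner integral does not depend on \<open>x\<close> by left invariance
  of \<open>dR\<close>. Hence \<open>\<mu>\<close> and the push-forwards of \<open>dR\<close> under all orbit maps \<open>R \<mapsto> R x\<close> have the same
  integrals; two orbit maps give the two right-hand sides.
\<close>

section \<open>Invariance, finiteness and positivity of the surface measure\<close>

text \<open>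
  The determinant is positive at the identity matrix and does not vanish on the segment of positive
  definite matrices from there to the Gram matrix.
\<close>

lemma gram_det_pos:
  fixes L :: "real^'k \<Rightarrow> 'a::euclidean_space"
  assumes "linear L" "inj L"
  shows "0 < det ((\<chi> i j. L (axis i 1) \<bullet> L (axis j 1)) :: real^'k^'k)"
proof -
  define G :: "real^'k^'k" where "G = (\<chi> i j. L (axis i 1) \<bullet> L (axis j 1))"
  \<comment> \<open>The quadratic form of the Gram matrix is |L x|^2, so injectivity of
    \<open>L\<close> makes \<open>G\<close> positive definite.\<close>
  have form: "x \<bullet> (G *v x) = L x \<bullet> L x" for x
  proof -
    have "L x = L (\<Sum>i\<in>UNIV. (x $ i) *\<^sub>R axis i 1)"
      using basis_expansion[of x] by (simp add: scalar_mult_eq_scaleR)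
    also have "\<dots> = (\<Sum>i\<in>UNIV. (x $ i) *\<^sub>R L (axis i 1))"
      using assms(1) by (simp add: linear_sum linear_scale)
    finally have "L x = (\<Sum>i\<in>UNIV. (x $ i) *\<^sub>R L (axis i 1))" .
    then show ?thesis
      by (simp add: G_def inner_vec_def matrix_vector_mult_def inner_sum_left inner_sum_right
          sum_distrib_left mult_ac inner_commute)
  qed
  define M where "M t = (1 - t) *\<^sub>R mat 1 + t *\<^sub>R G" for t :: real
  have nz: "det (M t) \<noteq> 0" if t: "0 \<le> t" "t \<le> 1" for t
  proof -
    have "x = 0" if "M t *v x = 0" for x
    proof (rule ccontr)
      assume "x \<noteq> 0"
      then have "L x \<noteq> 0"
        using assms linear_injective_0 by blast
      have "0 = x \<bullet> (M t *v x)"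
        using that by simp
      also have "\<dots> = (1 - t) * (x \<bullet> x) + t * (L x \<bullet> L x)"
        by (simp add: M_def matrix_vector_mult_add_rdistrib scaleR_matrix_vector_assoc [symmetric]
            inner_add_right form)
      also have "\<dots> > 0"
        using t \<open>x \<noteq> 0\<close> \<open>L x \<noteq> 0\<close>
        by (cases "t = 0") (auto intro!: add_nonneg_pos)
      finally show False by simp
    qed
    then show ?thesis
      by (metis invertible_det_nz invertible_left_inverse matrix_left_invertible_ker)
  qed
  have cont: "continuous_on {0..1} (\<lambda>t. det (M t))"
    unfolding det_def M_def by (intro continuous_intros | simp)+
  have "0 < det (M 1)"
  proof (rule ccontr)
    assume "\<not> 0 < det (M 1)"
    moreover have "det (M 0) = 1"
      by (simp add: M_def)
    ultimately obtain t where "0 \<le> t" "t \<le> 1" "det (M t) = 0"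
      using IVT2'[of "\<lambda>t. det (M t)" 1 0 0] cont by fastforce
    then show False using nz by blast
  qed
  then show ?thesis by (simp add: M_def G_def)
qed

lemma volume_density_pos:
  fixes L :: "real^'k \<Rightarrow> 'a::euclidean_space"
  assumes "linear L" "inj L"
  shows "0 < volume_density L"
  using gram_det_pos[OF assms] by (simp add: volume_density_def)

lemma continuous_on_volume_density:
  assumes "\<And>v. continuous_on U (\<lambda>x. D x v)"
  shows "continuous_on U (\<lambda>x. volume_density (D x))"
  unfolding volume_density_def det_def
  by (intro continuous_intros | simp add: assms)+

section \<open>Transport of charts by linear isometries\<close>

lemma orthogonal_transformation_homeomorphism:
  fixes T :: "'a::euclidean_space \<Rightarrow> 'a"
  assumes "orthogonal_transformation T"
  shows "homeomorphism X (T ` X) T (inv T)"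
proof -
  have "bij T" "orthogonal_transformation (inv T)"
    using assms by (auto intro: orthogonal_transformation_bij orthogonal_transformation_inv)
  then have "continuous_on A T" "continuous_on A (inv T)" for A
    using assms by (auto intro!: linear_continuous_on linear_linear[THEN iffD2]
      simp: linear_conv_bounded_linear[symmetric] orthogonal_transformation_linear)
  with \<open>bij T\<close> show ?thesis
    by (auto simp: homeomorphism_def image_comp o_def bij_is_inj image_inv_f_f)
qed

text \<open>The restriction of \<open>T\<close> to \<open>S\<close> is a homeomorphism of
  \<open>S\<close> onto itself, so openness in \<open>S\<close> survives, and the chain rule for the
  bounded linear map \<open>T\<close> gives the derivative. This serves both to compare a measure
  with its image under \<open>T\<close> and to spread one chart over a whole orbit.\<close>

lemma local_parametrization_orthogonal_image:
  fixes \<phi> :: "real^'k \<Rightarrow> 'a::euclidean_space"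
  assumes \<phi>: "local_parametrization S U \<phi> \<phi>'"
    and T: "orthogonal_transformation T" "T ` S = S"
  shows "local_parametrization S U (T \<circ> \<phi>) (\<lambda>x. T \<circ> \<phi>' x)"
proof -
  have lin: "bounded_linear T"
    using T(1) by (simp add: linear_conv_bounded_linear[symmetric] orthogonal_transformation_linear)
  have "openin (top_of_set S) (T ` (\<phi> ` U))"
    using homeomorphism_imp_open_map[OF orthogonal_transformation_homeomorphism[OF T(1), of S]]
      \<phi> T(2) by (simp add: local_parametrization_def)
  moreover obtain \<psi> where "homeomorphism U (\<phi> ` U) \<phi> \<psi>"
    using \<phi> by (auto simp: local_parametrization_def)
  then have "homeomorphism U (T ` (\<phi> ` U)) (T \<circ> \<phi>) (\<psi> \<circ> inv T)"
    by (rule homeomorphism_compose[OF _ orthogonal_transformation_homeomorphism[OF T(1)]])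
  moreover have "((T \<circ> \<phi>) has_derivative (T \<circ> \<phi>' x)) (at x)" "inj (T \<circ> \<phi>' x)" if "x \<in> U" for x
    using \<phi> that orthogonal_transformation_inj[OF T(1)]
    by (auto simp: local_parametrization_def o_def inj_compose[unfolded o_def]
        intro: bounded_linear.has_derivative[OF lin])
  moreover have "continuous_on U (\<lambda>x. (T \<circ> \<phi>' x) v)" for v
    using \<phi> by (auto simp: local_parametrization_def o_def intro!: bounded_linear.continuous_on[OF lin])
  ultimately show ?thesis
    using \<phi> by (auto simp: local_parametrization_def image_comp)
qed

text \<open>Disjointing the cover cuts every measurable set into countably many pieces, each inside
  a single \<open>V i\<close>. Since \<open>surface_measure\<close> prescribes values only inside
  single charts, this is how equality on charts becomes global.\<close>

lemma measure_eqI_countable_cover: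
  fixes V :: "nat \<Rightarrow> 'a set"
  assumes sets: "sets N = sets M" and V: "range V \<subseteq> sets M" "(\<Union>i. V i) = space M"
    and eq: "\<And>A i. A \<in> sets M \<Longrightarrow> A \<subseteq> V i \<Longrightarrow> emeasure M A = emeasure N A"
  shows "M = N"
proof (rule measure_eqI)
  fix A assume A: "A \<in> sets M"
  define B where "B i = A \<inter> disjointed V i" for i
  have B: "range B \<subseteq> sets M"
    using A sets.range_disjointed_sets[OF V(1)] by (auto simp: B_def)
  have disj: "disjoint_family B"
    using disjoint_family_disjointed[of V] by (auto simp: B_def disjoint_family_on_def)
  have UB: "(\<Union>i. B i) = A"
    using V(2) sets.sets_into_space[OF A] UN_disjointed_eq[of V] by (auto simp: B_def)
  have "emeasure M (B i) = emeasure N (B i)" for i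
    using B disjointed_subset[of V i] by (intro eq[of _ i]) (auto simp: B_def)
  then show "emeasure M A = emeasure N A"
    using suminf_emeasure[OF B disj] suminf_emeasure[of B N] B disj UB sets by simp
qed (use sets in simp)

lemma openin_borel_sets:
  assumes "S \<in> sets borel" "openin (top_of_set S) V"
  shows "V \<in> sets borel" "V \<subseteq> S"
  using assms by (auto simp: openin_open)

lemma local_parametrization_vimage_borel:
  assumes "local_parametrization S U \<phi> \<phi>'" "A \<in> sets borel"
  shows "{x \<in> U. \<phi> x \<in> A} \<in> sets borel"
proof -
  have U: "open U" "continuous_on U \<phi>"
    using assms by (auto simp: local_parametrization_def homeomorphism_def)
  then have "\<phi> -` A \<inter> space (restrict_space borel U) \<in> sets (restrict_space borel U)"
    using assms(2) by (intro measurable_sets[OF borel_measurable_continuous_on_restrict])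
  then show ?thesis
    using U by (simp add: sets_restrict_space_iff space_restrict_space vimage_def Int_def conj_commute)
qed

lemma surface_measure_chart:
  fixes \<phi> :: "real^'k::finite \<Rightarrow> 'a::euclidean_space"
  assumes "surface_measure TYPE('k) S \<sigma>" "local_parametrization S U \<phi> \<phi>'"
    and "B \<in> sets borel" "B \<subseteq> U"
  shows "emeasure \<sigma> (\<phi> ` B) = (\<integral>\<^sup>+x\<in>B. ennreal (volume_density (\<phi>' x)) \<partial>lborel)"
  using assms unfolding surface_measure_def by blast

text \<open>For a chart \<open>\<phi>\<close>, the map \<open>inv T \<circ> \<phi>\<close> is
  another chart, with the same Gram matrix because \<open>inv T\<close> preserves inner products.
  Hence a subset of a chart image and its preimage under \<open>T\<close> have the same measure, and
  countably many chart images cover \<open>S\<close>.\<close>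

proposition surface_measure_orthogonal_invariant:
  fixes \<sigma> :: "'a::euclidean_space measure"
  assumes \<sigma>: "surface_measure TYPE('k::finite) S \<sigma>" and S: "S \<in> sets borel"
    and charts: "\<And>x. x \<in> S \<Longrightarrow>
      \<exists>(U :: (real^'k) set) \<phi> \<phi>'. local_parametrization S U \<phi> \<phi>' \<and> x \<in> \<phi> ` U"
    and T: "orthogonal_transformation T" "T ` S = S"
  shows "distr \<sigma> \<sigma> T = \<sigma>"
proof -
  have sp: "space \<sigma> = S" and sets: "sets \<sigma> = {A \<in> sets borel. A \<subseteq> S}"
    using \<sigma> S by (auto simp: surface_measure_def sets_restrict_space_iff)
  define F where "F = {V. \<exists>(U :: (real^'k) set) \<phi> \<phi>'. local_parametrization S U \<phi> \<phi>' \<and> V = \<phi> ` U}"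
  have Fop: "openin (top_of_set S) V" if "V \<in> F" for V
    using that by (auto simp: F_def local_parametrization_def)
  \<comment> \<open>Lindelof: countably many chart images suffice, as countable additivity
    requires.\<close>
  obtain F' where F': "F' \<subseteq> F" "countable F'" "\<Union>F' = \<Union>F"
    using Lindelof_openin[of F S] Fop by metis
  have "\<Union>F = S"
    using charts openin_imp_subset[OF Fop] by (fastforce simp: F_def)
  show ?thesis
  proof (cases "S = {}")
    case True
    then show ?thesis
      by (intro measure_eqI) (auto simp: sets emeasure_distr sp)
  next
    case False
    \<comment> \<open>An enumeration of \<open>F'\<close> by the natural numbers exists only if
      \<open>F'\<close> is nonempty; hence the case split.\<close>
    then have "F' \<noteq> {}" using F' \<open>\<Union>F = S\<close> by auto
    then obtain V :: "nat \<Rightarrow> 'a set" where V: "range V = F'"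
      using F'(2) by (metis range_from_nat_into)
    have Tm: "T \<in> measurable \<sigma> \<sigma>"
    proof (rule measurableI)
      fix A assume A: "A \<in> sets \<sigma>"
      have "T \<in> borel_measurable borel"
        using T(1) by (intro borel_measurable_continuous_onI linear_continuous_on)
          (simp add: linear_conv_bounded_linear[symmetric] orthogonal_transformation_linear)
      from measurable_sets[OF this, of A] show "T -` A \<inter> space \<sigma> \<in> sets \<sigma>"
        using A S by (auto simp: sp sets)
    qed (use T(2) sp in auto)
    have "\<sigma> = distr \<sigma> \<sigma> T"
    proof (rule measure_eqI_countable_cover[of _ _ V])
      show "range V \<subseteq> sets \<sigma>"
      proof
        fix X assume "X \<in> range V"
        then show "X \<in> sets \<sigma>"
          using V F'(1) Fop[of X] openin_borel_sets[OF S, of X] by (auto simp: sets)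
      qed
      show "(\<Union>i. V i) = space \<sigma>"
        using V F'(3) \<open>\<Union>F = S\<close> sp by auto
      fix A i assume A: "A \<in> sets \<sigma>" "A \<subseteq> V i"
      obtain U :: "(real^'k) set" and \<phi> \<phi>' where
        \<phi>: "local_parametrization S U \<phi> \<phi>'" "V i = \<phi> ` U"
      proof -
        have "V i \<in> F"
          using V F'(1) by blast
        with that show ?thesis
          by (auto simp: F_def)
      qed
      define B where "B = {x \<in> U. \<phi> x \<in> A}"
      have B: "B \<in> sets borel" "B \<subseteq> U" "A = \<phi> ` B"
        using local_parametrization_vimage_borel[OF \<phi>(1), of A] A \<phi>(2)
        by (auto simp: sets B_def)
      have inv: "orthogonal_transformation (inv T)" "inv T ` S = S"
        using orthogonal_transformation_inv[OF T(1)]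
          image_inv_f_f[OF orthogonal_transformation_inj[OF T(1)], of S] T(2) by simp_all
      have "T -` A \<inter> S = inv T ` A"
        using image_mono[of A S "inv T"] A(1) inv(2)
          bij_vimage_eq_inv_image[OF orthogonal_transformation_bij[OF T(1)], of A]
        by (auto simp: sets)
      then have "emeasure (distr \<sigma> \<sigma> T) A = emeasure \<sigma> ((inv T \<circ> \<phi>) ` B)"
        using A Tm B(3) by (simp add: emeasure_distr sp image_comp)
      also have "\<dots> = (\<integral>\<^sup>+x\<in>B. ennreal (volume_density (inv T \<circ> \<phi>' x)) \<partial>lborel)"
        using surface_measure_chart[OF \<sigma> local_parametrization_orthogonal_image[OF \<phi>(1) inv]] B
        by simp
      also have "\<dots> = (\<integral>\<^sup>+x\<in>B. ennreal (volume_density (\<phi>' x)) \<partial>lborel)"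
        using inv(1) by (simp add: volume_density_def orthogonal_transformation_def)
      also have "\<dots> = emeasure \<sigma> A"
        using surface_measure_chart[OF \<sigma> \<phi>(1)] B by simp
      finally show "emeasure \<sigma> A = emeasure (distr \<sigma> \<sigma> T) A" ..
    qed simp
    then show ?thesis ..
  qed
qed

text \<open>Around each point a closed ball fits into a chart domain. The density is continuous,
  hence bounded there, so the image of the open ball has finite measure. Such images are relatively
  open, and by compactness finitely many of them cover \<open>S\<close>.\<close>

lemma surface_measure_finite:
  fixes \<sigma> :: "'a::euclidean_space measure"
  assumes \<sigma>: "surface_measure TYPE('k::finite) S \<sigma>" and S: "compact S"
    and charts: "\<And>x. x \<in> S \<Longrightarrow>
      \<exists>(U :: (real^'k) set) \<phi> \<phi>'. local_parametrization S U \<phi> \<phi>' \<and> x \<in> \<phi> ` U"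
  shows "emeasure \<sigma> S < \<infinity>"
proof -
  have sets: "sets \<sigma> = {A \<in> sets borel. A \<subseteq> S}"
    using \<sigma> S by (auto simp: surface_measure_def sets_restrict_space_iff borel_compact)
  have "\<exists>V. openin (top_of_set S) V \<and> x \<in> V \<and> emeasure \<sigma> V < \<infinity>" if x: "x \<in> S" for x
  proof -
    obtain U :: "(real^'k) set" and \<phi> \<phi>' z where
      \<phi>: "local_parametrization S U \<phi> \<phi>'" and z: "z \<in> U" "x = \<phi> z"
      using charts[OF x] by blast
    have U: "open U" "openin (top_of_set S) (\<phi> ` U)"
      using \<phi> by (auto simp: local_parametrization_def)
    obtain \<psi> where hom: "homeomorphism U (\<phi> ` U) \<phi> \<psi>"
      using \<phi> by (auto simp: local_parametrization_def)
    obtain r where r: "r > 0" "cball z r \<subseteq> U"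
      using U(1) z open_contains_cball by metis
    have sub: "ball z r \<subseteq> U"
      using r ball_subset_cball by blast
    have "continuous_on (cball z r) (\<lambda>x. volume_density (\<phi>' x))"
      using \<phi> r by (intro continuous_on_volume_density)
        (auto simp: local_parametrization_def intro: continuous_on_subset)
    then obtain K where K: "\<And>y. y \<in> cball z r \<Longrightarrow> volume_density (\<phi>' y) \<le> K"
      using compact_continuous_image[THEN compact_imp_bounded] compact_cball
      by (metis bounded_real abs_le_D1 image_eqI)
    have "openin (top_of_set U) (ball z r)"
      using sub by (simp add: U(1) openin_open_eq)
    then have "openin (top_of_set (\<phi> ` U)) (\<phi> ` ball z r)"
      using homeomorphism_imp_open_map[OF hom] by blast
    then have "openin (top_of_set S) (\<phi> ` ball z r)"
      using U(2) openin_trans by blast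
    moreover have "emeasure \<sigma> (\<phi> ` ball z r) < \<infinity>"
    proof -
      have "emeasure \<sigma> (\<phi> ` ball z r) = (\<integral>\<^sup>+x\<in>ball z r. ennreal (volume_density (\<phi>' x)) \<partial>lborel)"
        using surface_measure_chart[OF \<sigma> \<phi>] sub by simp
      also have "\<dots> \<le> (\<integral>\<^sup>+x. ennreal K * indicator (ball z r) x \<partial>lborel)"
        using K by (intro nn_integral_mono) (auto simp: indicator_def ennreal_leI)
      also have "\<dots> = ennreal K * emeasure lborel (ball z r)"
        by (simp add: nn_integral_cmult_indicator)
      also have "\<dots> < \<infinity>"
        using emeasure_lborel_ball_finite[of z r] by (simp add: ennreal_mult_less_top)
      finally show ?thesis .
    qed
    moreover have "x \<in> \<phi> ` ball z r"
      using z r by auto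
    ultimately show ?thesis
      by metis
  qed
  then obtain V where V: "\<And>x. x \<in> S \<Longrightarrow> openin (top_of_set S) (V x) \<and> x \<in> V x \<and> emeasure \<sigma> (V x) < \<infinity>"
    by metis
  obtain D where D: "D \<subseteq> V ` S" "finite D" "S \<subseteq> \<Union>D"
  proof -
    have "(\<forall>c\<in>V ` S. openin (top_of_set S) c) \<and> S \<subseteq> \<Union>(V ` S)"
      using V by auto
    with S that show ?thesis
      unfolding compact_eq_openin_cover by meson
  qed
  have Dsets: "X \<in> sets \<sigma>" "emeasure \<sigma> X < \<infinity>" if "X \<in> D" for X
  proof -
    obtain x where "x \<in> S" "X = V x"
      using \<open>X \<in> D\<close> D(1) by auto
    then show "X \<in> sets \<sigma>" "emeasure \<sigma> X < \<infinity>"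
      using V openin_borel_sets[of S X] S by (auto simp: sets borel_compact)
  qed
  have "emeasure \<sigma> S \<le> emeasure \<sigma> (\<Union>X\<in>D. X)"
    using D Dsets by (intro emeasure_mono) auto
  also have "\<dots> \<le> (\<Sum>X\<in>D. emeasure \<sigma> X)"
    using D Dsets by (intro emeasure_subadditive_finite) auto
  also have "\<dots> < \<infinity>"
    using D(2) Dsets by simp
  finally show ?thesis .
qed

text \<open>The density is strictly positive, so a vanishing integral over \<open>U\<close> would
  make \<open>U\<close> a null set, which a nonempty open set is not.\<close>

lemma surface_measure_pos:
  fixes \<sigma> :: "'a::euclidean_space measure" and U :: "(real^'k::finite) set"
  assumes \<sigma>: "surface_measure TYPE('k) S \<sigma>"
    and \<phi>: "local_parametrization S U \<phi> \<phi>'" and "U \<noteq> {}"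
  shows "emeasure \<sigma> (space \<sigma>) > 0"
proof -
  have U: "open U" and cont: "continuous_on U (\<lambda>x. volume_density (\<phi>' x))"
    using \<phi> continuous_on_volume_density[of U \<phi>'] by (auto simp: local_parametrization_def)
  have "emeasure \<sigma> (\<phi> ` U) \<noteq> 0"
  proof
    assume "emeasure \<sigma> (\<phi> ` U) = 0"
    then have "(\<integral>\<^sup>+x\<in>U. ennreal (volume_density (\<phi>' x)) \<partial>lborel) = 0"
      using surface_measure_chart[OF \<sigma> \<phi>] U by simp
    \<comment> \<open>The density is continuous on \<open>U\<close> only; extended by zero it is
      Borel.\<close>
    moreover have "(\<lambda>x. ennreal (volume_density (\<phi>' x)) * indicator U x) \<in> borel_measurable lborel"
    proof -
      have "(\<lambda>x. indicator U x *\<^sub>R volume_density (\<phi>' x)) \<in> borel_measurable borel"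
        using U cont by (intro borel_measurable_continuous_on_indicator) auto
      then have "(\<lambda>x. ennreal (indicator U x *\<^sub>R volume_density (\<phi>' x))) \<in> borel_measurable lborel"
        by measurable
      also have "(\<lambda>x. ennreal (indicator U x *\<^sub>R volume_density (\<phi>' x))) =
          (\<lambda>x. ennreal (volume_density (\<phi>' x)) * indicator U x)"
        by (auto simp: indicator_def)
      finally show ?thesis .
    qed
    ultimately have "AE x in lborel. ennreal (volume_density (\<phi>' x)) * indicator U x = 0"
      by (simp add: nn_integral_0_iff_AE)
    moreover have "0 < volume_density (\<phi>' x)" if "x \<in> U" for x
      using \<phi> that by (auto simp: local_parametrization_def intro!: volume_density_pos has_derivative_linear)
    ultimately have "AE x in lborel. x \<notin> U"
      by (elim AE_mp) (auto intro!: AE_I2 simp: indicator_def ennreal_eq_0_iff split: if_splits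
          dest: leD)
    then have "emeasure lborel U = 0"
      using U by (subst (asm) AE_iff_measurable[OF _ refl]) auto
    then show False
      using U \<open>U \<noteq> {}\<close> open_not_negligible negligible_iff_null_sets
      by (metis null_setsI null_sets_completionI borel_open sets_lborel)
  qed
  moreover have "emeasure \<sigma> (\<phi> ` U) \<le> emeasure \<sigma> (space \<sigma>)"
    by (rule emeasure_space)
  ultimately show ?thesis
    using not_gr_zero by fastforce
qed

section \<open>The manifold of triangles and the transitivity of the rotation group\<close>

text \<open>For unit vectors |u - v|^2 = 2 - 2 (u \<bullet> v), so the third side has length 1
  exactly when the angle at the origin is 60 degrees.\<close>

lemma triangle_manifold_iff:
  "(u, v) \<in> triangle_manifold \<longleftrightarrow> norm u = 1 \<and> norm v = 1 \<and> u \<bullet> v = 1 / 2"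
proof -
  have "norm (u - v) ^ 2 = 2 - 2 * (u \<bullet> v)" if "norm u = 1" "norm v = 1"
    using that by (simp add: power2_norm_eq_inner inner_diff inner_commute norm_eq_1)
  moreover have "norm (u - v) = 1 \<longleftrightarrow> norm (u - v) ^ 2 = 1"
    by (simp add: power2_eq_1_iff) (smt (verit) norm_ge_zero)
  ultimately show ?thesis
    by (auto simp: triangle_manifold_def)
qed

text \<open>The coefficients are the cosine and sine of 60 degrees, so a point of the manifold
  amounts to an orthonormal pair. For a unit vector \<open>u\<close> orthogonal to \<open>w\<close>,
  the second component has squared norm 1/4 + (3/4) |w|^2.\<close>

lemma triangle_manifold_frame_iff:
  "(u, (1 / 2) *\<^sub>R u + (sqrt 3 / 2) *\<^sub>R w) \<in> triangle_manifold \<longleftrightarrow>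
    norm u = 1 \<and> norm w = 1 \<and> u \<bullet> w = 0"
proof -
  let ?v = "(1 / 2) *\<^sub>R u + (sqrt 3 / 2) *\<^sub>R w"
  have "u \<bullet> ?v = 1 / 2 \<longleftrightarrow> u \<bullet> w = 0" if "norm u = 1"
    using that by (simp add: inner_add norm_eq_1)
  moreover have "norm ?v = 1 \<longleftrightarrow> norm w = 1" if "norm u = 1" "u \<bullet> w = 0"
    using that by (simp add: norm_eq_1 inner_add inner_commute field_simps)
  ultimately show ?thesis
    unfolding triangle_manifold_iff by blast
qed

lemma triangle_manifold_swap:
  "(u, v) \<in> triangle_manifold \<Longrightarrow> (v, u) \<in> triangle_manifold"
  by (auto simp: triangle_manifold_iff inner_commute)

lemma compact_triangle_manifold: "compact (triangle_manifold :: ((real^'n) \<times> (real^'n)) set)"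
proof -
  have "triangle_manifold =
      (sphere 0 1 \<times> sphere 0 1) \<inter> {x :: (real^'n) \<times> (real^'n). norm (fst x - snd x) = 1}"
    by (auto simp: triangle_manifold_def)
  moreover have "compact \<dots>"
    by (intro compact_Int_closed compact_Times compact_sphere closed_Collect_eq continuous_intros)
  ultimately show ?thesis
    by (rule ssubst)
qed

section \<open>Orthogonal maps between two given triangles\<close>

definition reflection :: "'a::real_inner \<Rightarrow> 'a \<Rightarrow> 'a"
  where "reflection a x = x - (2 * (x \<bullet> a) / (a \<bullet> a)) *\<^sub>R a"

lemma orthogonal_transformation_reflection:
  "orthogonal_transformation (reflection a)"
proof -
  have "linear (reflection a)"
    by (intro linearI) (auto simp: reflection_def inner_add_left algebra_simps add_divide_distrib)
  then show ?thesis
    by (auto simp: orthogonal_transformation_def reflection_def inner_diff inner_commute)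
qed

lemma reflection_orthogonal: "x \<bullet> a = 0 \<Longrightarrow> reflection a x = x"
  by (simp add: reflection_def)

text \<open>The mirror is the perpendicular bisector of \<open>x\<close> and \<open>y\<close>: equal
  norms give 2 (x \<bullet> (x - y)) = |x - y|^2, so the coefficient in \<open>reflection\<close> is
  1. For \<open>x = y\<close> the division by zero yields 0 and the reflection is the
  identity.\<close>

lemma reflection_swap:
  assumes "norm x = norm y"
  shows "reflection (x - y) x = y"
proof (cases "x = y")
  case False
  have "2 * (x \<bullet> (x - y)) = (x - y) \<bullet> (x - y)"
    using assms by (simp add: norm_eq inner_diff inner_commute)
  then show ?thesis
    using False by (simp add: reflection_def)
qed (simp add: reflection_def)

text \<open>The reflection in the hyperplane orthogonal to \<open>c\<close> is written as a sign
  change of one coordinate, conjugated by an orthogonal matrix, so that its determinant can be read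
  off a diagonal matrix. It serves to correct orientation without moving vectors orthogonal to
  \<open>c\<close>.\<close>

lemma rotoinversion_fixing_orthogonal_exists:
  fixes c :: "real^'n"
  assumes "c \<noteq> 0"
  obtains N :: "real^'n^'n" where "rotoinversion_matrix N" "\<And>x. x \<bullet> c = 0 \<Longrightarrow> N *v x = x"
proof -
  \<comment> \<open>Any coordinate will do as the one that changes sign.\<close>
  obtain k :: 'n where True by blast
  obtain h where h: "orthogonal_transformation h" "h ((1 / norm c) *\<^sub>R c) = axis k (1::real)"
    using orthogonal_transformation_exists[of "(1 / norm c) *\<^sub>R c" "axis k (1::real)"] assms by auto
  define D :: "real^'n^'n" where "D = (\<chi> i j. if i = j then if i = k then -1 else 1 else 0)"
  define A where "A = matrix h"
  have A: "orthogonal_matrix A" "\<And>x. A *v x = h x"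
    using h(1) by (auto simp: A_def orthogonal_transformation_matrix matrix_works linear_matrix_vector_mul_eq)
  have Dv: "D *v x = (\<chi> i. if i = k then - x $ i else x $ i)" for x
    by (auto simp: D_def matrix_vector_mult_def vec_eq_iff if_distrib[of "\<lambda>t. t * _"] cong: if_cong)
  have detD: "det D = -1"
  proof -
    have "det D = (\<Prod>i\<in>UNIV. D $ i $ i)"
      by (rule det_diagonal) (simp add: D_def)
    also have "\<dots> = -1"
      by (simp add: D_def)
    finally show ?thesis .
  qed
  have D: "orthogonal_matrix D"
  proof -
    have "transpose D = D"
      by (auto simp: D_def transpose_def vec_eq_iff)
    then show ?thesis
      by (simp add: orthogonal_matrix matrix_eq matrix_vector_mul_assoc[symmetric] Dv vec_eq_iff)
  qed
  show thesis
  proof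
    have "orthogonal_matrix (transpose A ** D ** A)"
      using A D by (simp add: orthogonal_matrix_mul)
    moreover have "det (transpose A ** D ** A) = -1"
      using det_orthogonal_matrix[OF A(1)] detD by (auto simp: det_mul)
    ultimately show "rotoinversion_matrix (transpose A ** D ** A)"
      by (simp add: rotoinversion_matrix_def)
    fix x assume "x \<bullet> c = 0"
    then have "h x \<bullet> axis k 1 = 0"
      using h by (metis inner_scaleR_right mult_zero_right orthogonal_transformation_def)
    then have "D *v (h x) = h x"
      by (auto simp: Dv vec_eq_iff inner_axis)
    then show "(transpose A ** D ** A) *v x = x"
      using A by (metis matrix_mul_lid matrix_vector_mul_assoc matrix_vector_mul_lid orthogonal_matrix)
  qed
qed

text \<open>An orthogonal map sends \<open>x\<close> to \<open>u\<close>; a reflection then carries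
  the image of \<open>y\<close> to \<open>v\<close> without moving \<open>u\<close>. If the
  determinant is -1, a reflection fixing \<open>u\<close> and \<open>v\<close> repairs it. Its
  normal vector must be orthogonal to both, which is where dimension at least 3 enters.\<close>

lemma SO_transitive_triangle_manifold:
  fixes u v x y :: "real^'n"
  assumes n: "CARD('n) \<ge> 3"
    and "(x, y) \<in> triangle_manifold" "(u, v) \<in> triangle_manifold"
  obtains R where "R \<in> SO" "R *v x = u" "R *v y = v"
proof -
  have xy: "norm x = 1" "norm y = 1" "x \<bullet> y = 1 / 2" and uv: "norm u = 1" "norm v = 1" "u \<bullet> v = 1 / 2"
    using assms by (auto simp: triangle_manifold_iff)
  obtain g where g: "orthogonal_transformation g" "g x = u"
    using orthogonal_transformation_exists xy uv by metis
  define f where "f = reflection (g y - v) \<circ> g"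
  have f: "orthogonal_transformation f"
    using g by (simp add: f_def orthogonal_transformation_compose orthogonal_transformation_reflection)
  have "u \<bullet> g y = 1 / 2"
    using g xy by (metis orthogonal_transformation_def)
  \<comment> \<open>Both \<open>g y\<close> and \<open>v\<close> have inner product 1/2 with
    \<open>u\<close>, so \<open>u\<close> lies on the mirror.\<close>
  then have fx: "f x = u"
    using uv by (simp add: f_def g reflection_orthogonal inner_diff)
  have fy: "f y = v"
    using g xy uv by (simp add: f_def reflection_swap orthogonal_transformation_norm)
  define A where "A = matrix f"
  have A: "orthogonal_matrix A" "A *v x = u" "A *v y = v"
    using f fx fy by (auto simp: A_def orthogonal_transformation_matrix matrix_works)
  consider "rotation_matrix A" | "rotoinversion_matrix A"
    using A orthogonal_rotation_or_rotoinversion by blast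
  then show thesis
  proof cases
    case 1
    then show thesis using that A by (simp add: SO_def)
  next
    case 2
    have "dim {u, v} < DIM(real^'n)"
      using dim_le_card'[of "{u, v}"] card_insert_le_m1[of 2 "{v}" u] n by simp
    then obtain c where "c \<noteq> 0" "orthogonal u c" "orthogonal v c"
      using orthogonal_to_subspace_exists[of "{u, v}"]
      by (metis insertI1 insertI2 orthogonal_commute span_base)
    then obtain N :: "real^'n^'n" where N: "rotoinversion_matrix N" "N *v u = u" "N *v v = v"
      using rotoinversion_fixing_orthogonal_exists[of c] by (metis orthogonal_def)
    have "N ** A \<in> SO"
      using 2 N by (auto simp: SO_def rotation_matrix_def rotoinversion_matrix_def
          orthogonal_matrix_mul det_mul)
    moreover have "(N ** A) *v x = u" "(N ** A) *v y = v"
      using A N by (auto simp: matrix_vector_mul_assoc[symmetric])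
    ultimately show thesis using that by blast
  qed
qed

section \<open>Linear coordinates for the chart, and the derivative of normalization\<close>

lemma orthogonal_frame_coordinates:
  fixes e1 e2 :: "'a::euclidean_space"
  assumes dim: "DIM('b::euclidean_space) = 2 * DIM('a) - 3"
    and e: "norm e1 = 1" "norm e2 = 1" "e1 \<bullet> e2 = 0"
  obtains L :: "'b::euclidean_space \<Rightarrow> 'a \<times> 'a" and G where
    "linear L" "linear G" "\<And>z. G (L z) = z"
    "\<And>z. fst (L z) \<bullet> e1 = 0" "\<And>z. snd (L z) \<bullet> e1 = 0" "\<And>z. snd (L z) \<bullet> e2 = 0"
    "\<And>p q. p \<bullet> e1 = 0 \<Longrightarrow> q \<bullet> e1 = 0 \<Longrightarrow> q \<bullet> e2 = 0 \<Longrightarrow> L (G (p, q)) = (p, q)"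
proof -
  \<comment> \<open>The admissible pairs \<open>(p, q)\<close> form the orthogonal complement of
    these three mutually orthogonal vectors. Its dimension is twice that of \<open>'a\<close> minus
    3, so it is isometric to \<open>'b\<close>.\<close>
  define B where "B = {(e1, 0), (0, e1), (0, e2)}"
  define S where "S = {y \<in> UNIV. \<forall>x\<in>span B. orthogonal x y}"
  have ne: "e1 \<noteq> 0" "e2 \<noteq> 0" "e1 \<noteq> e2"
    using e by auto
  have "independent B"
    using e ne by (intro pairwise_orthogonal_independent)
      (auto simp: B_def pairwise_def orthogonal_def inner_commute zero_prod_def)
  moreover have "card B = 3"
    using ne by (auto simp: B_def)
  ultimately have dimB: "dim (span B) = 3"
    by (simp add: dim_eq_card_independent)
  have "dim S + dim (span B) = dim (UNIV :: ('a \<times> 'a) set)"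
    unfolding S_def
    by (rule dim_subspace_orthogonal_to_vectors[OF subspace_span subspace_UNIV subset_UNIV])
  then have dimS: "dim (UNIV :: 'b set) = dim S"
    using dimB dim by simp
  have subS: "subspace S"
    using subspace_orthogonal_to_vectors[of "span B"] by (simp add: S_def)
  obtain L :: "'b \<Rightarrow> 'a \<times> 'a" and G where LG: "linear L" "linear G" "range L = S" "G ` S = UNIV"
    "\<And>x. x \<in> UNIV \<Longrightarrow> norm (L x) = norm x" "\<And>x. x \<in> S \<Longrightarrow> norm (G x) = norm x"
    "\<And>z. z \<in> UNIV \<Longrightarrow> G (L z) = z" "\<And>s. s \<in> S \<Longrightarrow> L (G s) = s"
    by (rule isometries_subspaces[OF subspace_UNIV subS dimS]) (rule that)
  have S: "s \<in> S \<longleftrightarrow> fst s \<bullet> e1 = 0 \<and> snd s \<bullet> e1 = 0 \<and> snd s \<bullet> e2 = 0" for s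
  proof -
    have "s \<in> S \<longleftrightarrow> (\<forall>x\<in>B. orthogonal s x)"
      unfolding S_def using orthogonal_to_span[of _ B s]
      by (auto simp: orthogonal_commute span_base simp del: split_paired_All)
    then show ?thesis
      by (cases s) (auto simp: B_def orthogonal_def)
  qed
  have "L z \<in> S" for z
    using LG(3) by auto
  then show thesis
    using LG S by (intro that[of L G]) auto
qed

text \<open>Radial motion does not change the direction, so the derivative projects off
  \<open>sgn x\<close> and divides by the norm; it comes from the product rule for x / |x|.\<close>

lemma has_derivative_sgn:
  fixes x :: "'a::real_inner"
  assumes "x \<noteq> 0"
  shows "(sgn has_derivative (\<lambda>h. (h - (sgn x \<bullet> h) *\<^sub>R sgn x) /\<^sub>R norm x)) (at x)"
proof -
  have "((\<lambda>x. inverse (norm x) *\<^sub>R x) has_derivative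
      (\<lambda>h. inverse (norm x) *\<^sub>R h + (- (inverse (norm x) * (h \<bullet> sgn x) * inverse (norm x))) *\<^sub>R x)) (at x)"
    using assms has_derivative_norm[of x] by (auto intro!: derivative_eq_intros)
  moreover have "(\<lambda>h. inverse (norm x) *\<^sub>R h + (- (inverse (norm x) * (h \<bullet> sgn x) * inverse (norm x))) *\<^sub>R x) =
    (\<lambda>h. (h - (sgn x \<bullet> h) *\<^sub>R sgn x) /\<^sub>R norm x)"
    by (auto simp: fun_eq_iff sgn_div_norm algebra_simps inner_commute)
  moreover have "(\<lambda>x::'a. inverse (norm x) *\<^sub>R x) = sgn"
    by (auto simp: fun_eq_iff sgn_div_norm)
  ultimately show ?thesis by simp
qed

section \<open>A chart of the manifold of triangles\<close>

text \<open>The ray through \<open>x\<close> meets the hyperplane of vectors having inner product 1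
  with \<open>e\<close> only in \<open>x\<close>, so rescaling onto it undoes normalization. The
  inverse chart uses this with \<open>e1\<close> for \<open>a\<close> and \<open>e2\<close> for
  \<open>b\<close>.\<close>

lemma sgn_div_inner:
  fixes x :: "'a::real_inner"
  assumes "x \<bullet> e = 1"
  shows "sgn x /\<^sub>R (sgn x \<bullet> e) = x"
proof -
  have "norm x \<noteq> 0" using assms by auto
  then show ?thesis
    using assms by (simp add: sgn_div_norm)
qed

text \<open>
  Each \<open>x = (u, u/2 + (\<surd>3/2) w) \<in> M\<close> is given by an orthonormal pair \<open>(u, w)\<close>. Near \<open>(e\<^sub>1, e\<^sub>2)\<close> such pairs
  are normalizations of \<open>a = e\<^sub>1 + p\<close> and \<open>b = e\<^sub>2 + q - ((e\<^sub>2 + q) \<bullet> p) e\<^sub>1\<close> with \<open>p \<bottom> e\<^sub>1\<close> and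
  \<open>q \<bottom> e\<^sub>1, e\<^sub>2\<close>, where the last term of \<open>b\<close> makes it orthogonal to \<open>a\<close>. The inverse \<open>\<psi>\<close>
  rescales \<open>u\<close> and \<open>w\<close>; it is differentiable in the ambient space, which makes \<open>\<phi>'\<close> injective.
\<close>

lemma triangle_manifold_local_parametrization:
  fixes e1 e2 :: "real^'n"
  assumes dim: "CARD('k::finite) = 2 * CARD('n) - 3"
    and e: "norm e1 = 1" "norm e2 = 1" "e1 \<bullet> e2 = 0"
  obtains \<phi> \<phi>' where "local_parametrization triangle_manifold (UNIV :: (real^'k) set) \<phi> \<phi>'"
    "(e1, (1 / 2) *\<^sub>R e1 + (sqrt 3 / 2) *\<^sub>R e2) \<in> range \<phi>"
proof -
  have ee: "e1 \<bullet> e1 = 1" "e2 \<bullet> e2 = 1" "e2 \<bullet> e1 = 0"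
    using e by (simp_all add: norm_eq_1 inner_commute)
  have "DIM(real^'k) = 2 * DIM(real^'n) - 3"
    using dim by simp
  then obtain L :: "real^'k \<Rightarrow> (real^'n) \<times> (real^'n)" and G where L: "linear L" "linear G" "\<And>z. G (L z) = z"
    "\<And>z. fst (L z) \<bullet> e1 = 0" "\<And>z. snd (L z) \<bullet> e1 = 0" "\<And>z. snd (L z) \<bullet> e2 = 0"
    and LG: "\<And>p q. p \<bullet> e1 = 0 \<Longrightarrow> q \<bullet> e1 = 0 \<Longrightarrow> q \<bullet> e2 = 0 \<Longrightarrow> L (G (p, q)) = (p, q)"
    using orthogonal_frame_coordinates[OF _ e, where 'b = "real^'k"] by blast
  define P where "P z = fst (L z)" for z
  define Q where "Q z = snd (L z)" for z
  have bl: "bounded_linear L" "bounded_linear G"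
    using L by (simp_all add: linear_conv_bounded_linear)
  have blP: "bounded_linear P" and blQ: "bounded_linear Q"
    unfolding P_def Q_def
    by (intro bounded_linear_fst_comp bounded_linear_snd_comp bl)+
  note cPQ [continuous_intros] = bounded_linear.continuous_on[OF blP] bounded_linear.continuous_on[OF blQ]
  have PQ: "P z \<bullet> e1 = 0" "Q z \<bullet> e1 = 0" "Q z \<bullet> e2 = 0" "L z = (P z, Q z)"
    "e1 \<bullet> P z = 0" "e1 \<bullet> Q z = 0" "e2 \<bullet> Q z = 0" for z
    using L by (simp_all add: P_def Q_def inner_commute)
  define a where "a z = e1 + P z" for z
  define b where "b z = e2 + Q z - ((e2 + Q z) \<bullet> P z) *\<^sub>R e1" for z
  \<comment> \<open>\<open>b' z\<close> is the derivative of \<open>b\<close> at \<open>z\<close> by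
    the product rule; \<open>N x\<close> below is that of \<open>sgn\<close> at
    \<open>x\<close>.\<close>
  define b' where "b' z v = Q v - ((e2 + Q z) \<bullet> P v + Q v \<bullet> P z) *\<^sub>R e1" for z v
  have ab: "a z \<bullet> e1 = 1" "b z \<bullet> e2 = 1" "a z \<bullet> b z = 0" "b z \<bullet> e1 = - ((e2 + Q z) \<bullet> P z)" for z
    using PQ[of z] ee e by (simp_all add: a_def b_def inner_diff inner_add inner_commute)
  then have nz: "a z \<noteq> 0" "b z \<noteq> 0" for z
    by (metis inner_zero_left zero_neq_one)+
  define N where "N x h = (h - (sgn x \<bullet> h) *\<^sub>R sgn x) /\<^sub>R norm x" for x h :: "real^'n"
  define \<phi> where "\<phi> z = (sgn (a z), (1 / 2) *\<^sub>R sgn (a z) + (sqrt 3 / 2) *\<^sub>R sgn (b z))" for z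
  define \<phi>' where "\<phi>' z v = (N (a z) (P v), (1 / 2) *\<^sub>R N (a z) (P v) + (sqrt 3 / 2) *\<^sub>R N (b z) (b' z v))" for z v
  \<comment> \<open>\<open>W\<close> recovers the second vector \<open>w\<close> of the orthonormal
    pair from \<open>x = (u, v)\<close>.\<close>
  define W where "W x = (2 / sqrt 3) *\<^sub>R (snd x - (1 / 2) *\<^sub>R fst x)" for x :: "(real^'n) \<times> (real^'n)"
  define \<psi> where "\<psi> x = G (fst x /\<^sub>R (fst x \<bullet> e1) - e1,
    W x /\<^sub>R (W x \<bullet> e2) - ((W x \<bullet> e1) / (W x \<bullet> e2)) *\<^sub>R e1 - e2)" for x
  \<comment> \<open>On this open set both denominators in \<open>\<psi>\<close> are positive; its
    intersection with the manifold turns out to be the chart image.\<close>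
  define X where "X = {x. 0 < fst x \<bullet> e1 \<and> 0 < W x \<bullet> e2}"
  have contW: "continuous_on A W" for A
    unfolding W_def by (intro continuous_intros)
  note contW' [continuous_intros] = continuous_on_compose2[OF contW[of UNIV] _ subset_UNIV]
  have "open X"
    unfolding X_def by (intro open_Collect_conj open_Collect_less continuous_intros)

  have frame: "(u, v) \<in> triangle_manifold \<longleftrightarrow> norm u = 1 \<and> norm (W (u, v)) = 1 \<and> u \<bullet> W (u, v) = 0" for u v
    using triangle_manifold_frame_iff[of u "W (u, v)"] by (simp add: W_def)
  have W\<phi>: "W (\<phi> z) = sgn (b z)" for z
    by (simp add: W_def \<phi>_def)
  have \<phi>M: "\<phi> z \<in> triangle_manifold" for z
    unfolding \<phi>_def triangle_manifold_frame_iff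
    using nz ab(3) by (simp add: norm_sgn) (simp add: sgn_div_norm)
  have \<phi>X: "\<phi> z \<in> X" for z
    using nz[of z] ab[of z] by (simp add: X_def W\<phi>) (simp add: \<phi>_def sgn_div_norm)
  have \<psi>\<phi>: "\<psi> (\<phi> z) = z" for z
  proof -
    have "fst (\<phi> z) /\<^sub>R (fst (\<phi> z) \<bullet> e1) = a z"
      using sgn_div_inner[OF ab(1)] by (simp add: \<phi>_def)
    moreover have "sgn (b z) /\<^sub>R (sgn (b z) \<bullet> e2) = b z"
      by (rule sgn_div_inner[OF ab(2)])
    moreover have "(sgn (b z) \<bullet> e1) / (sgn (b z) \<bullet> e2) = b z \<bullet> e1"
      using nz[of z] ab(2)[of z] by (simp add: sgn_div_norm)
    ultimately have "\<psi> (\<phi> z) = G (a z - e1, b z - (b z \<bullet> e1) *\<^sub>R e1 - e2)"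
      by (simp add: \<psi>_def W\<phi>)
    \<comment> \<open>By \<open>ab(4)\<close>, removing the \<open>e1\<close> component of
      \<open>b z\<close> cancels the correction term and leaves \<open>e2 + Q z\<close>.\<close>
    also have "\<dots> = G (P z, Q z)"
      by (simp add: ab(4)) (simp add: a_def b_def)
    finally show ?thesis
      using L(3) PQ(4) by simp
  qed
  have \<phi>\<psi>: "\<phi> (\<psi> x) = x" if x: "x \<in> triangle_manifold" "x \<in> X" for x
  proof -
    obtain u v where uv: "x = (u, v)" by (cases x)
    define w where "w = W x"
    define p where "p = u /\<^sub>R (u \<bullet> e1) - e1"
    define q where "q = w /\<^sub>R (w \<bullet> e2) - ((w \<bullet> e1) / (w \<bullet> e2)) *\<^sub>R e1 - e2"
    have pos: "0 < u \<bullet> e1" "0 < w \<bullet> e2"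
      using x(2) by (auto simp: X_def uv w_def)
    have uw: "norm u = 1" "norm w = 1" "u \<bullet> w = 0"
      using x(1) frame[of u v] by (auto simp: uv w_def)
    have "p \<bullet> e1 = 0" "q \<bullet> e1 = 0" "q \<bullet> e2 = 0"
      using pos ee e by (auto simp: p_def q_def inner_diff divide_inverse)
    then have "L (\<psi> x) = (p, q)"
      using LG by (simp add: \<psi>_def uv p_def q_def w_def)
    then have PQx: "P (\<psi> x) = p" "Q (\<psi> x) = q"
      by (simp_all add: P_def Q_def)
    have ax: "a (\<psi> x) = u /\<^sub>R (u \<bullet> e1)"
      by (simp add: a_def PQx p_def)
    \<comment> \<open>Orthogonality of \<open>u\<close> and \<open>w\<close> gives this value, so
      the correction term in \<open>b\<close> restores exactly the \<open>e1\<close> component that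
      \<open>q\<close> discards.\<close>
    have "(e2 + q) \<bullet> p = - ((w \<bullet> e1) / (w \<bullet> e2))"
      using pos uw ee e by (simp add: p_def q_def inner_diff inner_commute divide_inverse)
    then have bx: "b (\<psi> x) = w /\<^sub>R (w \<bullet> e2)"
      by (simp add: b_def PQx) (simp add: q_def)
    have "sgn (a (\<psi> x)) = u" "sgn (b (\<psi> x)) = w"
      using pos uw by (simp_all add: ax bx sgn_scaleR) (simp_all add: sgn_div_norm)
    then show ?thesis
      by (simp add: \<phi>_def uv w_def W_def)
  qed
  have range: "range \<phi> = triangle_manifold \<inter> X"
    using \<phi>M \<phi>X \<phi>\<psi> by (auto simp: image_iff) metis

  have der: "(\<phi> has_derivative \<phi>' z) (at z)" for z
  proof -
    have da: "(a has_derivative P) (at z)"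
      unfolding a_def using bounded_linear.has_derivative[OF blP has_derivative_ident, of "at z"]
      by (auto intro!: derivative_eq_intros)
    have db: "(b has_derivative b' z) (at z)"
      unfolding b_def b'_def using bounded_linear.has_derivative[OF blP has_derivative_ident, of "at z"]
        bounded_linear.has_derivative[OF blQ has_derivative_ident, of "at z"]
      by (auto intro!: derivative_eq_intros)
    have "((\<lambda>z. sgn (a z)) has_derivative (\<lambda>v. N (a z) (P v))) (at z)"
      unfolding N_def by (rule has_derivative_compose[OF da has_derivative_sgn[OF nz(1)]])
    moreover have "((\<lambda>z. sgn (b z)) has_derivative (\<lambda>v. N (b z) (b' z v))) (at z)"
      unfolding N_def by (rule has_derivative_compose[OF db has_derivative_sgn[OF nz(2)]])
    ultimately show ?thesis
      unfolding \<phi>_def \<phi>'_def by (intro derivative_intros)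
  qed
  have inj: "inj (\<phi>' z)" for z
  proof -
    have n: "fst (\<phi> z) \<bullet> e1 \<noteq> 0" "W (\<phi> z) \<bullet> e2 \<noteq> 0"
      using \<phi>X[of z] by (auto simp: X_def)
    have dF: "((\<lambda>x. fst x) has_derivative (\<lambda>h. fst h)) (at (\<phi> z))"
      and dW: "((\<lambda>x. W x) has_derivative (\<lambda>h. W h)) (at (\<phi> z))"
      unfolding W_def by (intro derivative_intros)+
    note in1 = bounded_linear.has_derivative[OF bounded_linear_inner_left[of e1]]
    note in2 = bounded_linear.has_derivative[OF bounded_linear_inner_left[of e2]]
    \<comment> \<open>It only matters that \<open>\<psi>\<close> has some derivative at
      \<open>\<phi> z\<close>: by the chain rule for \<open>\<psi> \<circ> \<phi>\<close>, which is
      the identity, it is a left inverse of \<open>\<phi>' z\<close>. The formula is therefore left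
      to unification.\<close>
    have "\<exists>D. ((\<lambda>x. fst x /\<^sub>R (fst x \<bullet> e1) - e1) has_derivative D) (at (\<phi> z))"
      by (rule exI, rule has_derivative_diff[OF has_derivative_scaleR[OF
          Deriv.has_derivative_inverse[where f = "\<lambda>x. fst x \<bullet> e1", OF n(1) in1[OF dF]] dF]
          has_derivative_const])
    moreover have "\<exists>D. ((\<lambda>x. W x /\<^sub>R (W x \<bullet> e2) - ((W x \<bullet> e1) / (W x \<bullet> e2)) *\<^sub>R e1 - e2)
        has_derivative D) (at (\<phi> z))"
      by (rule exI, rule has_derivative_diff[OF has_derivative_diff[OF has_derivative_scaleR[OF
          Deriv.has_derivative_inverse[where f = "\<lambda>x. W x \<bullet> e2", OF n(2) in2[OF dW]] dW]
          has_derivative_scaleR[OF has_derivative_divide'[where f = "\<lambda>x. W x \<bullet> e1"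
            and g = "\<lambda>x. W x \<bullet> e2", OF in1[OF dW] in2[OF dW] n(2)] has_derivative_const]]
          has_derivative_const])
    ultimately obtain D where D: "((\<lambda>x. (fst x /\<^sub>R (fst x \<bullet> e1) - e1,
        W x /\<^sub>R (W x \<bullet> e2) - ((W x \<bullet> e1) / (W x \<bullet> e2)) *\<^sub>R e1 - e2)) has_derivative D) (at (\<phi> z))"
      using has_derivative_Pair by blast
    have "(\<psi> has_derivative (G \<circ> D)) (at (\<phi> z))"
      unfolding \<psi>_def o_def by (rule bounded_linear.has_derivative[OF bl(2) D])
    then have "((\<psi> \<circ> \<phi>) has_derivative ((G \<circ> D) \<circ> \<phi>' z)) (at z)"
      by (rule diff_chain_at[OF der])
    moreover have "\<psi> \<circ> \<phi> = (\<lambda>x. x)"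
      by (auto simp: \<psi>\<phi>)
    ultimately have "(G \<circ> D) \<circ> \<phi>' z = (\<lambda>x. x)"
      using has_derivative_unique has_derivative_ident by metis
    then show ?thesis
      by (metis (mono_tags, lifting) comp_apply injI)
  qed
  have cont\<phi>': "continuous_on UNIV (\<lambda>z. \<phi>' z v)" for v
    unfolding \<phi>'_def N_def b'_def using nz
    by (intro continuous_intros) (auto simp: a_def b_def intro!: continuous_intros)
  have cont\<psi>: "continuous_on (range \<phi>) \<psi>"
    unfolding \<psi>_def range X_def
    by (intro bounded_linear.continuous_on[OF bl(2)] continuous_intros) auto
  have cont\<phi>: "continuous_on UNIV \<phi>"
    by (rule has_derivative_continuous_on, rule has_derivative_at_withinI, rule der)
  have "homeomorphism UNIV (range \<phi>) \<phi> \<psi>"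
    by (rule homeomorphismI[OF cont\<phi> cont\<psi>]) (auto simp: \<psi>\<phi>)
  moreover have "openin (top_of_set triangle_manifold) (range \<phi>)"
    unfolding range using \<open>open X\<close> by auto
  ultimately have "local_parametrization triangle_manifold UNIV \<phi> \<phi>'"
    unfolding local_parametrization_def using der inj cont\<phi>' open_UNIV by blast
  moreover have "P 0 = 0" "Q 0 = 0"
    using L(1) by (simp_all add: P_def Q_def linear_0)
  then have "\<phi> 0 = (e1, (1 / 2) *\<^sub>R e1 + (sqrt 3 / 2) *\<^sub>R e2)"
    using e by (simp add: \<phi>_def a_def b_def sgn_div_norm)
  then have "(e1, (1 / 2) *\<^sub>R e1 + (sqrt 3 / 2) *\<^sub>R e2) \<in> range \<phi>"
    by (metis rangeI)
  ultimately show thesis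
    by (rule that)
qed

section \<open>Invariant probability measures\<close>

definition diagonal_action :: "real^'n^'n \<Rightarrow> (real^'n) \<times> (real^'n) \<Rightarrow> (real^'n) \<times> (real^'n)"
  where "diagonal_action R x = (R *v fst x, R *v snd x)"

lemma diagonal_action_mult: "diagonal_action (A ** B) x = diagonal_action A (diagonal_action B x)"
  by (simp add: diagonal_action_def matrix_vector_mul_assoc)

lemma orthogonal_transformation_diagonal_action:
  assumes "orthogonal_matrix R"
  shows "orthogonal_transformation (diagonal_action R)"
proof -
  have "orthogonal_transformation ((*v) R)"
    using assms by (simp add: orthogonal_transformation_matrix matrix_vector_mul_linear)
  then show ?thesis
    unfolding orthogonal_transformation_def diagonal_action_def
    by (auto simp: inner_prod_def linear_iff matrix_vector_right_distrib matrix_vector_mult_scaleR)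
qed

lemma SO_transpose: "R \<in> SO \<Longrightarrow> transpose R \<in> SO"
  by (auto simp: SO_def rotation_matrix_def)

lemma SO_mult: "Q \<in> SO \<Longrightarrow> R \<in> SO \<Longrightarrow> Q ** R \<in> SO"
  by (auto simp: SO_def rotation_matrix_def orthogonal_matrix_mul det_mul)

lemma diagonal_action_triangle_manifold:
  assumes "R \<in> SO" "x \<in> triangle_manifold"
  shows "diagonal_action R x \<in> triangle_manifold"
proof -
  have "norm (R *v z) = norm z" for z
    using assms(1) orthogonal_transformation_norm[of "(*v) R"]
    by (auto simp: SO_def rotation_matrix_def orthogonal_transformation_matrix matrix_vector_mul_linear)
  then show ?thesis
    using assms(2) by (auto simp: triangle_manifold_def diagonal_action_def
        simp flip: matrix_vector_mult_diff_distrib)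
qed

lemma diagonal_action_image_triangle_manifold:
  assumes "R \<in> SO"
  shows "diagonal_action R ` triangle_manifold = triangle_manifold"
proof -
  have "R ** transpose R = mat 1"
    using assms by (auto simp: SO_def rotation_matrix_def orthogonal_matrix_def)
  then have "x = diagonal_action R (diagonal_action (transpose R) x)" for x
    by (simp add: diagonal_action_mult[symmetric]) (simp add: diagonal_action_def)
  then show ?thesis
    using diagonal_action_triangle_manifold[OF assms]
      diagonal_action_triangle_manifold[OF SO_transpose[OF assms]] by (auto simp: image_iff) metis
qed

lemma diagonal_action_transitive:
  fixes x y :: "(real^'n) \<times> (real^'n)"
  assumes "CARD('n) \<ge> 3" and "x \<in> triangle_manifold" "y \<in> triangle_manifold"
  obtains Q where "Q \<in> SO" "diagonal_action Q x = y"
proof -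
  obtain Q where "Q \<in> SO" "Q *v fst x = fst y" "Q *v snd x = snd y"
    using assms(2,3) by (auto intro: SO_transitive_triangle_manifold[OF assms(1), of "fst x" "snd x" "fst y" "snd y"])
  then show thesis
    using that by (simp add: diagonal_action_def)
qed

section \<open>Averaging over the group\<close>

lemma borel_measurable_ident_restrict_space:
  assumes "sets M = sets (restrict_space borel S)"
  shows "(\<lambda>x. x) \<in> borel_measurable M"
  unfolding measurable_cong_sets[OF assms refl] by (rule measurable_restrict_space1) simp

text \<open>The transpose is the inverse of a rotation. If x = Q x0, then R^T x = (Q^T R)^T x0, so a
  change of base point is a left translation of \<open>R\<close>, which \<open>H\<close> absorbs.
  Boundedness of \<open>F\<close> provides the integrability for Fubini's theorem.\<close>

lemma integral_invariant_eq_integral_haar: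
  fixes F :: "(real^'n) \<times> (real^'n) \<Rightarrow> complex"
  assumes n: "CARD('n) \<ge> 3"
    and \<nu>: "prob_space \<nu>" "sets \<nu> = sets (restrict_space borel triangle_manifold)"
    and inv: "\<And>Q. Q \<in> SO \<Longrightarrow> distr \<nu> \<nu> (diagonal_action Q) = \<nu>"
    and H: "haar_probability_SO H"
    and F: "F \<in> borel_measurable borel" "\<And>x. norm (F x) \<le> K"
    and x0: "x0 \<in> triangle_manifold"
  shows "(LINT x|\<nu>. F x) = (LINT R|H. F (diagonal_action (transpose R) x0))"
proof -
  interpret \<nu>: prob_space \<nu> by fact
  interpret H: prob_space H using H by (simp add: haar_probability_SO_def)
  interpret P: pair_prob_space H \<nu> ..
  have spH: "space H = SO" and setsH: "sets H = sets (restrict_space borel SO)"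
    using H by (auto simp: haar_probability_SO_def)
  have sp\<nu>: "space \<nu> = triangle_manifold"
    using sets_eq_imp_space_eq[OF \<nu>(2)] by (simp add: space_restrict_space)
  have idH: "(\<lambda>R. R) \<in> borel_measurable H"
    using setsH by (rule borel_measurable_ident_restrict_space)
  have id\<nu>: "(\<lambda>x. x) \<in> borel_measurable \<nu>"
    using \<nu>(2) by (rule borel_measurable_ident_restrict_space)
  \<comment> \<open>The maps \<open>g\<close> and \<open>h\<close> are arbitrary because this is
    used on the product space, for a fixed rotation and for a fixed point.\<close>
  have act: "(\<lambda>y. diagonal_action (transpose (g y)) (h y)) \<in> borel_measurable N"
    if "g \<in> borel_measurable N" "h \<in> borel_measurable N" for g :: "'b \<Rightarrow> real^'n^'n" and h and N
  proof -
    have "continuous_on UNIV (\<lambda>p :: (real^'n^'n) \<times> (real^'n) \<times> (real^'n).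
        diagonal_action (transpose (fst p)) (snd p))"
      unfolding diagonal_action_def matrix_vector_mult_def transpose_def
      by (intro continuous_on_Pair continuous_on_vec_lambda continuous_intros)
    from borel_measurable_continuous_on[OF this borel_measurable_Pair[OF that]] show ?thesis
      by simp
  qed
  have meas: "(\<lambda>(R, x). F (diagonal_action (transpose R) x)) \<in> borel_measurable (H \<Otimes>\<^sub>M \<nu>)"
    unfolding case_prod_beta
    by (intro measurable_compose[OF _ F(1)] act measurable_compose[OF measurable_fst idH]
        measurable_compose[OF measurable_snd id\<nu>])
  have "(LINT x|\<nu>. F x) = (LINT x|\<nu>. F (diagonal_action (transpose R) x))" if "R \<in> space H" for R
  proof -
    have R: "transpose R \<in> SO"
      using that SO_transpose spH by blast
    have "diagonal_action (transpose R) \<in> measurable \<nu> (restrict_space borel triangle_manifold)"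
      using act[of "\<lambda>_. R" \<nu> "\<lambda>x. x"] id\<nu> diagonal_action_triangle_manifold[OF R] sp\<nu>
      by (intro measurable_restrict_space2) auto
    then have m: "diagonal_action (transpose R) \<in> measurable \<nu> \<nu>"
      using measurable_cong_sets[OF refl \<nu>(2)] by blast
    have "(LINT x|\<nu>. F x) = (LINT x|distr \<nu> \<nu> (diagonal_action (transpose R)). F x)"
      by (simp add: inv[OF R])
    also have "\<dots> = (LINT x|\<nu>. F (diagonal_action (transpose R) x))"
      by (intro integral_distr m measurable_compose[OF id\<nu> F(1)])
    finally show ?thesis .
  qed
  then have "(LINT R|H. (LINT x|\<nu>. F (diagonal_action (transpose R) x))) = (LINT R|H. (LINT x|\<nu>. F x))"
    by (rule Bochner_Integration.integral_cong[OF refl, OF sym])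
  also have "\<dots> = (LINT x|\<nu>. F x)"
    by (simp add: H.prob_space)
  finally have 1: "(LINT R|H. (LINT x|\<nu>. F (diagonal_action (transpose R) x))) = (LINT x|\<nu>. F x)" .
  have 2: "(LINT R|H. F (diagonal_action (transpose R) x)) = (LINT R|H. F (diagonal_action (transpose R) x0))"
    if "x \<in> space \<nu>" for x
  proof -
    have x: "x \<in> triangle_manifold"
      using that sp\<nu> by simp
    obtain Q where Q: "Q \<in> SO" "diagonal_action Q x0 = x"
      by (rule diagonal_action_transitive[OF n x0 x])
    have Q': "transpose Q \<in> SO"
      using Q(1) by (rule SO_transpose)
    have "(\<lambda>R. transpose Q ** R) \<in> borel_measurable H"
    proof -
      have "continuous_on UNIV (\<lambda>R :: real^'n^'n. transpose Q ** R)"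
        unfolding matrix_matrix_mult_def
        by (intro continuous_on_vec_lambda continuous_intros)
      from borel_measurable_continuous_on[OF this idH] show ?thesis .
    qed
    then have "(\<lambda>R. transpose Q ** R) \<in> measurable H (restrict_space borel SO)"
      using SO_mult[OF Q'] spH by (intro measurable_restrict_space2) auto
    then have m: "(\<lambda>R. transpose Q ** R) \<in> measurable H H"
      using measurable_cong_sets[OF refl setsH] by blast
    have "(LINT R|H. F (diagonal_action (transpose R) x0)) =
        (LINT R|distr H H (\<lambda>R. transpose Q ** R). F (diagonal_action (transpose R) x0))"
      using H Q' by (simp add: haar_probability_SO_def)
    also have "\<dots> = (LINT R|H. F (diagonal_action (transpose (transpose Q ** R)) x0))"
      by (intro integral_distr m measurable_compose[OF _ F(1)] act idH borel_measurable_const)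
    also have "\<dots> = (LINT R|H. F (diagonal_action (transpose R) x))"
      by (simp add: matrix_transpose_mul diagonal_action_mult Q(2))
    finally show ?thesis ..
  qed
  have "integrable (H \<Otimes>\<^sub>M \<nu>) (\<lambda>(R, x). F (diagonal_action (transpose R) x))"
    by (rule P.integrable_const_bound[of _ K, OF AE_I2 meas]) (simp add: case_prod_beta F(2))
  from P.Fubini_integral[OF this] 1
  have "(LINT x|\<nu>. F x) = (LINT x|\<nu>. (LINT R|H. F (diagonal_action (transpose R) x)))"
    by simp
  also have "\<dots> = (LINT x|\<nu>. (LINT R|H. F (diagonal_action (transpose R) x0)))"
    by (rule Bochner_Integration.integral_cong[OF refl 2])
  also have "\<dots> = (LINT R|H. F (diagonal_action (transpose R) x0))"
    by (simp add: \<nu>.prob_space)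
  finally show ?thesis .
qed

text \<open>Since Q (R x0) = (Q R) x0, left invariance of \<open>H\<close> passes to its
  push-forward along the orbit map. Fed into \<open>integral_invariant_eq_integral_haar\<close>,
  this relates orbit integrals over \<open>R\<close> to those over its transpose, and so removes the
  inverse again.\<close>

lemma haar_orbit_distr:
  fixes H :: "(real^'n^'n) measure"
  assumes H: "haar_probability_SO H" and x0: "x0 \<in> triangle_manifold"
  defines "M \<equiv> restrict_space borel triangle_manifold :: ((real^'n) \<times> (real^'n)) measure"
  defines "\<nu> \<equiv> distr H M (\<lambda>R. diagonal_action R x0)"
  shows "prob_space \<nu>" "sets \<nu> = sets M"
    "\<And>Q. Q \<in> SO \<Longrightarrow> distr \<nu> \<nu> (diagonal_action Q) = \<nu>"
    "\<And>F :: _ \<Rightarrow> complex. F \<in> borel_measurable borel \<Longrightarrow> (LINT x|\<nu>. F x) = (LINT R|H. F (diagonal_action R x0))"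
proof -
  interpret H: prob_space H using H by (simp add: haar_probability_SO_def)
  have spH: "space H = SO" and setsH: "sets H = sets (restrict_space borel SO)"
    using H by (auto simp: haar_probability_SO_def)
  have idH: "(\<lambda>R. R) \<in> borel_measurable H"
    using setsH by (rule borel_measurable_ident_restrict_space)
  have cont1: "continuous_on UNIV (\<lambda>R :: real^'n^'n. diagonal_action R x0)"
    unfolding diagonal_action_def matrix_vector_mult_def
    by (intro continuous_on_Pair continuous_on_vec_lambda continuous_intros)
  have m: "(\<lambda>R. diagonal_action R x0) \<in> measurable H M"
    unfolding M_def using borel_measurable_continuous_on[OF cont1 idH] spH x0
    by (intro measurable_restrict_space2) (auto intro: diagonal_action_triangle_manifold)
  show "prob_space \<nu>" "sets \<nu> = sets M"
    using H.prob_space_distr[OF m] by (simp_all add: \<nu>_def)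
  have idM: "(\<lambda>x. x) \<in> borel_measurable M"
    by (simp add: M_def measurable_restrict_space1)
  show "(LINT x|\<nu>. F x) = (LINT R|H. F (diagonal_action R x0))" if "F \<in> borel_measurable borel"
    for F :: "_ \<Rightarrow> complex"
    unfolding \<nu>_def by (intro integral_distr m measurable_compose[OF idM that])
  fix Q :: "real^'n^'n" assume Q: "Q \<in> SO"
  have "continuous_on UNIV (diagonal_action Q)"
    unfolding diagonal_action_def matrix_vector_mult_def
    by (intro continuous_on_Pair continuous_on_vec_lambda continuous_intros)
  from borel_measurable_continuous_on[OF this idM]
  have Qm: "diagonal_action Q \<in> measurable M M"
    unfolding M_def using diagonal_action_triangle_manifold[OF Q]
    by (intro measurable_restrict_space2) (auto simp: space_restrict_space)
  have "continuous_on UNIV (\<lambda>R :: real^'n^'n. Q ** R)"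
    unfolding matrix_matrix_mult_def
    by (intro continuous_on_vec_lambda continuous_intros)
  from borel_measurable_continuous_on[OF this idH]
  have "(\<lambda>R. Q ** R) \<in> measurable H (restrict_space borel SO)"
    using SO_mult[OF Q] spH by (intro measurable_restrict_space2) auto
  then have Qm': "(\<lambda>R. Q ** R) \<in> measurable H H"
    using measurable_cong_sets[OF refl setsH] by blast
  \<comment> \<open>The target of \<open>distr\<close> matters only through its sets, which are
    those of \<open>M\<close>.\<close>
  have "distr \<nu> \<nu> (diagonal_action Q) = distr \<nu> M (diagonal_action Q)"
    by (rule distr_cong) (auto simp: \<nu>_def)
  also have "\<dots> = distr H M (\<lambda>R. diagonal_action (Q ** R) x0)"
    by (simp add: \<nu>_def distr_distr[OF Qm m] o_def diagonal_action_mult)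
  also have "\<dots> = distr (distr H H (\<lambda>R. Q ** R)) M (\<lambda>R. diagonal_action R x0)"
    by (simp add: distr_distr[OF m Qm'] o_def)
  also have "\<dots> = \<nu>"
    using H Q by (simp add: \<nu>_def haar_probability_SO_def)
  finally show "distr \<nu> \<nu> (diagonal_action Q) = \<nu>" .
qed

section \<open>The normalized surface measure and the integral formula\<close>

lemma normalized_measure_prob_space:
  assumes "0 < emeasure \<sigma> (space \<sigma>)" "emeasure \<sigma> (space \<sigma>) < \<infinity>"
  shows "prob_space (normalized_measure \<sigma>)"
proof (rule prob_spaceI)
  \<comment> \<open>In \<open>ennreal\<close> this cancellation fails for 0 and infinity; hence the
    need for a positive and finite total mass.\<close>
  have "(1 / c) * c = 1" if "0 < c" "c < \<infinity>" for c :: ennreal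
    using that by (metis ennreal_divide_self ennreal_divide_times infinity_ennreal_def
        less_irrefl mult.commute mult_1 ennreal_times_divide mult.right_neutral)
  then show "emeasure (normalized_measure \<sigma>) (space (normalized_measure \<sigma>)) = 1"
    using assms by (simp add: normalized_measure_def space_scale_measure)
qed

lemma normalized_measure_distr_invariant:
  assumes T: "T \<in> measurable \<sigma> \<sigma>" and inv: "distr \<sigma> \<sigma> T = \<sigma>"
  shows "distr (normalized_measure \<sigma>) (normalized_measure \<sigma>) T = normalized_measure \<sigma>"
proof (rule measure_eqI)
  fix A assume "A \<in> sets (distr (normalized_measure \<sigma>) (normalized_measure \<sigma>) T)"
  then have A: "A \<in> sets \<sigma>"
    by (simp add: normalized_measure_def)
  have T': "T \<in> measurable (normalized_measure \<sigma>) (normalized_measure \<sigma>)"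
    using T by (simp add: normalized_measure_def measurable_def space_scale_measure)
  have "emeasure \<sigma> (T -` A \<inter> space \<sigma>) = emeasure \<sigma> A"
    using emeasure_distr[OF T A] inv by simp
  then show "emeasure (distr (normalized_measure \<sigma>) (normalized_measure \<sigma>) T) A =
      emeasure (normalized_measure \<sigma>) A"
    using emeasure_distr[OF T', of A] A by (simp add: normalized_measure_def space_scale_measure)
qed simp

text \<open>A chart around one base triangle is explicit. Rotations act transitively and carry
  charts to charts, so its translates reach every point.\<close>

lemma triangle_manifold_charts:
  fixes x :: "(real^'n) \<times> (real^'n)"
  assumes n: "CARD('n) \<ge> 3" and k: "CARD('k::finite) = 2 * CARD('n) - 3"
    and x: "x \<in> triangle_manifold"
  shows "\<exists>(U :: (real^'k) set) \<phi> \<phi>'. local_parametrization triangle_manifold U \<phi> \<phi>' \<and> x \<in> \<phi> ` U"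
proof -
  have "\<not> is_singleton (UNIV :: 'n set)"
    using n by (simp add: is_singleton_altdef)
  then obtain i j :: 'n where ij: "i \<noteq> j"
    by (metis UNIV_I is_singletonI' empty_not_UNIV)
  define e1 e2 :: "real^'n" where "e1 = axis i 1" and "e2 = axis j 1"
  have e: "norm e1 = 1" "norm e2 = 1" "e1 \<bullet> e2 = 0"
    using ij by (simp_all add: e1_def e2_def inner_axis_axis)
  let ?x0 = "(e1, (1 / 2) *\<^sub>R e1 + (sqrt 3 / 2) *\<^sub>R e2)"
  obtain \<phi> \<phi>' where \<phi>: "local_parametrization triangle_manifold (UNIV :: (real^'k) set) \<phi> \<phi>'"
    and x0: "?x0 \<in> range \<phi>"
    by (rule triangle_manifold_local_parametrization[OF k e])
  have "?x0 \<in> triangle_manifold"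
    using e by (simp only: triangle_manifold_frame_iff)
  then obtain Q where Q: "Q \<in> SO" "diagonal_action Q ?x0 = x"
    by (rule diagonal_action_transitive[OF n _ x])
  have "orthogonal_transformation (diagonal_action Q)"
    using Q(1) by (auto simp: SO_def rotation_matrix_def intro: orthogonal_transformation_diagonal_action)
  then have "local_parametrization triangle_manifold UNIV (diagonal_action Q \<circ> \<phi>) (\<lambda>x. diagonal_action Q \<circ> \<phi>' x)"
    using local_parametrization_orthogonal_image[OF \<phi>] diagonal_action_image_triangle_manifold[OF Q(1)] by blast
  moreover have "x \<in> range (diagonal_action Q \<circ> \<phi>)"
    using x0 Q(2) by (auto simp: image_iff)
  ultimately show ?thesis
    by blast
qed

theorem mainTheorem3:
  fixes f :: "(real^'n) \<times> (real^'n) \<Rightarrow> complex"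
    and \<sigma> \<mu> :: "((real^'n) \<times> (real^'n)) measure"
    and H :: "(real^'n^'n) measure"
    and i1 i2 :: 'n
    and e1 e2 :: "real^'n"
  assumes "CARD('n) \<ge> 3"
    and "CARD('k::finite) = 2 * CARD('n) - 3"
    and "surface_measure TYPE('k) triangle_manifold \<sigma>"
    and "\<mu> = normalized_measure \<sigma>"
    and "haar_probability_SO H"
    and "i1 \<noteq> i2" and "e1 = axis i1 1" and "e2 = axis i2 1"
    and "continuous_on triangle_manifold f"
  shows "(LINT (x, y)|\<mu>. f (x, y)) =
      (LINT R|H. f (R *v e1, R *v ((1 / 2) *\<^sub>R e1 + (sqrt 3 / 2) *\<^sub>R e2))) \<and>
    (LINT R|H. f (R *v e1, R *v ((1 / 2) *\<^sub>R e1 + (sqrt 3 / 2) *\<^sub>R e2))) =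
      (LINT R|H. f (R *v ((1 / 2) *\<^sub>R e1 + (sqrt 3 / 2) *\<^sub>R e2), R *v e1))"
proof -
  let ?M = "triangle_manifold :: ((real^'n) \<times> (real^'n)) set"
  note n = assms(1) and \<sigma> = assms(3) and H = assms(5)
  note charts = triangle_manifold_charts[OF n assms(2)]
  have M: "compact ?M" "?M \<in> sets borel"
    by (simp_all add: compact_triangle_manifold borel_compact)
  have sp\<sigma>: "space \<sigma> = ?M" and sets\<sigma>: "sets \<sigma> = sets (restrict_space borel ?M)"
    using \<sigma> by (auto simp: surface_measure_def)
  then have sp\<mu>: "space \<mu> = ?M" and sets\<mu>: "sets \<mu> = sets (restrict_space borel ?M)"
    by (simp_all add: assms(4) normalized_measure_def space_scale_measure)
  have e: "norm e1 = 1" "norm e2 = 1" "e1 \<bullet> e2 = 0"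
    using assms(6-8) by (simp_all add: inner_axis_axis)
  define v where "v = (1 / 2) *\<^sub>R e1 + (sqrt 3 / 2) *\<^sub>R e2"
  have x0: "(e1, v) \<in> ?M"
    unfolding v_def triangle_manifold_frame_iff using e by simp
  then have x1: "(v, e1) \<in> ?M"
    by (rule triangle_manifold_swap)

  have inv: "distr \<sigma> \<sigma> (diagonal_action Q) = \<sigma>" if Q: "Q \<in> SO" for Q
  proof (rule surface_measure_orthogonal_invariant[OF \<sigma> M(2) charts])
    show "orthogonal_transformation (diagonal_action Q)"
      using Q by (auto simp: SO_def rotation_matrix_def intro: orthogonal_transformation_diagonal_action)
  qed (use diagonal_action_image_triangle_manifold[OF Q] in auto)
  have inv\<mu>: "distr \<mu> \<mu> (diagonal_action Q) = \<mu>" if Q: "Q \<in> SO" for Q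
    unfolding assms(4)
  proof (rule normalized_measure_distr_invariant[OF _ inv[OF Q]])
    have "continuous_on UNIV (diagonal_action Q)"
      unfolding diagonal_action_def matrix_vector_mult_def
      by (intro continuous_on_Pair continuous_on_vec_lambda continuous_intros)
    from borel_measurable_continuous_on[OF this borel_measurable_ident_restrict_space[OF sets\<sigma>]]
    have "diagonal_action Q \<in> measurable \<sigma> (restrict_space borel ?M)"
      using diagonal_action_triangle_manifold[OF Q] sp\<sigma> by (intro measurable_restrict_space2) auto
    then show "diagonal_action Q \<in> measurable \<sigma> \<sigma>"
      using measurable_cong_sets[OF refl sets\<sigma>] by blast
  qed
  have \<mu>: "prob_space \<mu>"
    unfolding assms(4)
  proof (rule normalized_measure_prob_space)
    obtain U :: "(real^'k) set" and \<phi> \<phi>' where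
      "local_parametrization ?M U \<phi> \<phi>'" "(e1, v) \<in> \<phi> ` U"
      using charts[OF x0] by blast
    then show "0 < emeasure \<sigma> (space \<sigma>)"
      using surface_measure_pos[OF \<sigma>] by blast
    show "emeasure \<sigma> (space \<sigma>) < \<infinity>"
      unfolding sp\<sigma> by (rule surface_measure_finite[OF \<sigma> M(1) charts])
  qed

  \<comment> \<open>Extended by zero, \<open>f\<close> becomes a Borel function on all pairs; it is
    bounded because the manifold is compact.\<close>
  define F where "F x = indicator ?M x *\<^sub>R f x" for x
  have F: "F \<in> borel_measurable borel"
    unfolding F_def using M(2) assms(9) by (rule borel_measurable_continuous_on_indicator)
  have Ff: "F x = f x" if "x \<in> ?M" for x
    using that by (simp add: F_def)
  have "bounded (f ` ?M)"
    by (intro compact_imp_bounded compact_continuous_image assms(9) M(1))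
  then obtain K0 where K0: "\<And>x. x \<in> ?M \<Longrightarrow> norm (f x) \<le> K0"
    by (auto simp: bounded_iff)
  have K: "norm (F x) \<le> max 0 K0" for x
    using K0[of x] by (cases "x \<in> ?M") (auto simp: F_def)

  note integral = integral_invariant_eq_integral_haar[OF n _ _ _ H F K]
  \<comment> \<open>The right-hand side does not depend on \<open>x\<close>: the averaging lemma is
    applied to the push-forward of \<open>H\<close> along the orbit of \<open>x\<close>, always with
    base point \<open>(e1, v)\<close>. The choices \<open>(e1, v)\<close> and \<open>(v, e1)\<close>
    of \<open>x\<close> give the two group integrals.\<close>
  have orbit: "(LINT R|H. F (diagonal_action R x)) = (LINT R|H. F (diagonal_action (transpose R) (e1, v)))"
    if "x \<in> ?M" for x
    using haar_orbit_distr(4)[OF H that F] integral[OF haar_orbit_distr(1-3)[OF H that] x0] by simp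
  have act: "(LINT R|H. F (diagonal_action R x)) = (LINT R|H. f (R *v fst x, R *v snd x))"
    if "x \<in> ?M" for x
  proof (rule Bochner_Integration.integral_cong[OF refl])
    fix R assume "R \<in> space H"
    then have "R \<in> SO"
      using H by (simp add: haar_probability_SO_def)
    then have "diagonal_action R x \<in> ?M"
      using that by (rule diagonal_action_triangle_manifold)
    then show "F (diagonal_action R x) = f (R *v fst x, R *v snd x)"
      by (simp add: Ff) (simp add: diagonal_action_def)
  qed
  have "(LINT (x, y)|\<mu>. f (x, y)) = (LINT x|\<mu>. F x)"
    by (rule Bochner_Integration.integral_cong[OF refl]) (simp add: sp\<mu> Ff)
  also have "\<dots> = (LINT R|H. F (diagonal_action (transpose R) (e1, v)))"
    by (rule integral[OF \<mu> sets\<mu> inv\<mu> x0])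
  finally show ?thesis
    using orbit[OF x0] orbit[OF x1] act[OF x0] act[OF x1] by (simp add: v_def)
qed

end
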